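(* Let $\alpha>3$, $\beta>0$, $t_0>0$, and let $\Phi:\mathcal H\to\mathbb R$ be a twice continuously differentiable convex function such that $\operatorname{argmin}\Phi\neq\emptyset$ and $\nabla\Phi$ is uniformly monotone on bounded sets. Let $x:[t_0,+\infty[\to\mathcal H$ be a classical global solution of $$\ddot x(t)+\frac{\alpha}{t}\dot x(t)+\beta\nabla^2\Phi(x(t))\dot x(t)+\nabla\Phi(x(t))=0 .$$ Then $\operatorname{argmin}\Phi$ is reduced to a singleton $\{x^*\}$, and $x(t)$ converges strongly to $x^*$ as $t\to+\infty$.
   Context: $\mathcal H$ is a real Hilbert space with inner product $\langle\cdot,\cdot\rangle$ and norm $\|\cdot\|$. $\nabla\Phi$ is uniformly monotone on bounded sets if, for each $r>0$, there exists a nondecreasing function $\omega_r:[0,+\infty[\to[0,+\infty[$ vanishing only at $0$ such that $\langle\nabla\Phi(x)-\nabla\Phi(y),x-y\rangle\ge\omega_r(\|x-y\|)$ for all $x,y\in\mathcal H$ with $\|x\|\le r$ and $\|y\|\le r$. A classical global solution is a twice continuously differentiable function satisfying the equation for all $t\ge t_0$. *)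

theory Defs
  imports "HOL-Analysis.Analysis"
begin

text \<open>Twice continuous Frechet differentiability, with continuity of the second derivative in
  the operator norm. Derivatives are taken within \<open>S\<close>, hence one-sided at the endpoint of a
  half-line; \<open>f'\<close> and \<open>f''\<close> are unique for the two sets used below, the whole space and a half-line.\<close>

definition C2_on :: "'a::real_normed_vector set \<Rightarrow> ('a \<Rightarrow> 'b::real_normed_vector) \<Rightarrow> bool" where
  "C2_on S f \<longleftrightarrow>
     (\<exists>(f' :: 'a \<Rightarrow> 'a \<Rightarrow>\<^sub>L 'b) (f'' :: 'a \<Rightarrow> 'a \<Rightarrow>\<^sub>L ('a \<Rightarrow>\<^sub>L 'b)).
        (\<forall>x\<in>S. (f has_derivative blinfun_apply (f' x)) (at x within S)) \<and>
        (\<forall>x\<in>S. (f' has_derivative blinfun_apply (f'' x)) (at x within S)) \<and>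
        continuous_on S f'')"

definition gradient :: "('a::real_inner \<Rightarrow> real) \<Rightarrow> 'a \<Rightarrow> 'a" where
  "gradient f x = (THE g. GDERIV f x :> g)"

text \<open>The Hessian at \<open>x\<close> as an operator on the space, not as a bilinear form.\<close>

definition hessian :: "('a::real_inner \<Rightarrow> real) \<Rightarrow> 'a \<Rightarrow> 'a \<Rightarrow> 'a" where
  "hessian f x = frechet_derivative (gradient f) (at x)"

definition argmin :: "('a \<Rightarrow> real) \<Rightarrow> 'a set" where
  "argmin f = {x. is_arg_min f (\<lambda>_. True) x}"

definition uniformly_monotone_on_bounded_sets :: "('a::real_inner \<Rightarrow> 'a) \<Rightarrow> bool" where
  "uniformly_monotone_on_bounded_sets F \<longleftrightarrow>
     (\<forall>r>0. \<exists>\<omega> :: real \<Rightarrow> real.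
        mono_on {0..} \<omega> \<and> (\<forall>s\<ge>0. \<omega> s \<ge> 0) \<and> (\<forall>s\<ge>0. \<omega> s = 0 \<longleftrightarrow> s = 0) \<and>
        (\<forall>x y. norm x \<le> r \<longrightarrow> norm y \<le> r \<longrightarrow> inner (F x - F y) (x - y) \<ge> \<omega> (norm (x - y))))"

text \<open>Only the values of \<open>x\<close> on \<open>{t0..}\<close> matter; \<open>x'\<close> and \<open>x''\<close> in the body are the first and
  second time derivatives of the trajectory on the half-line.\<close>

definition classical_global_solution ::
  "real \<Rightarrow> real \<Rightarrow> real \<Rightarrow> ('a::real_inner \<Rightarrow> real) \<Rightarrow> (real \<Rightarrow> 'a) \<Rightarrow> bool" where
  "classical_global_solution \<alpha> \<beta> t0 \<Phi> x \<longleftrightarrow>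
     C2_on {t0..} x \<and>
     (let x' = (\<lambda>t. vector_derivative x (at t within {t0..}));
          x'' = (\<lambda>t. vector_derivative x' (at t within {t0..}))
      in \<forall>t\<ge>t0. x'' t + (\<alpha> / t) *\<^sub>R x' t + \<beta> *\<^sub>R hessian \<Phi> (x t) (x' t) + gradient \<Phi> (x t) = 0)"

end

theory Submission
  imports Defs
begin

text \<open>Along a trajectory the Hessian term is the time derivative of \<open>\<beta> \<nabla>\<Phi>(x(t))\<close>, so with
  \<open>v = x' + \<beta> \<nabla>\<Phi>(x)\<close> the equation has the first-order form \<open>v' = - (\<alpha>/t) x' - \<nabla>\<Phi>(x)\<close>. For a minimizer
  \<open>z\<close> and \<open>2 < \<lambda> < \<alpha> - 1\<close>, the function
  \<open>(t\<^sup>2 - \<beta>(\<lambda>+2-\<alpha>)t) (\<Phi>(x) - \<Phi>(z)) + \<parallel>\<lambda>(x - z) + t v\<parallel>\<^sup>2/2 + \<lambda>(\<alpha>-\<lambda>-1)\<parallel>x - z\<parallel>\<^sup>2/2\<close>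
  is nonincreasing for large \<open>t\<close>. Hence \<open>x\<close> is bounded and \<open>\<Phi>(x) - \<Phi>(z) = O(1/t\<^sup>2)\<close>. Uniform
  monotonicity, applied to \<open>z\<close> and the midpoint of \<open>x\<close> and \<open>z\<close>, turns the decay of the values into
  strong convergence.\<close>

section \<open>Riesz representation and gradients\<close>

lemma parallelogram_midpoint:
  fixes a b :: "'a::real_inner"
  shows "(norm (a - b))\<^sup>2 / 4 = (norm a)\<^sup>2 / 2 + (norm b)\<^sup>2 / 2 - (norm ((1/2) *\<^sub>R (a + b)))\<^sup>2"
  by (simp add: power2_norm_eq_inner inner_simps inner_commute[of b a] field_simps)

text \<open>The representing vector minimizes \<open>\<parallel>y\<parallel>\<^sup>2/2 - f y\<close>; minimizing sequences are Cauchy by the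
  parallelogram law.\<close>

lemma riesz_representation:
  fixes f :: "'a::{real_inner, complete_space} \<Rightarrow> real"
  assumes "bounded_linear f"
  shows "\<exists>y. \<forall>h. f h = inner y h"
proof -
  interpret f: bounded_linear f by fact
  define q where "q y = (norm y)\<^sup>2 / 2 - f y" for y
  obtain K where K: "\<And>y. norm (f y) \<le> norm y * K" using f.bounded by blast
  have "q y \<ge> - K\<^sup>2 / 2" for y
  proof -
    have "0 \<le> (norm y - K)\<^sup>2" by simp
    moreover have "f y \<le> norm y * K" using K[of y] by simp
    ultimately show ?thesis unfolding q_def by (simp add: power2_diff)
  qed
  then have bdd: "bdd_below (range q)" by (auto simp: bdd_below_def)
  define m where "m = Inf (range q)"
  have m_le: "m \<le> q y" for y unfolding m_def by (rule cInf_lower) (use bdd in auto)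
  have "\<exists>y. q y < m + 1 / real (Suc n)" for n
    using cInf_lessD[of "range q" "m + 1 / real (Suc n)"] unfolding m_def by auto
  then obtain Y where Y: "\<And>n. q (Y n) < m + 1 / real (Suc n)" by metis
  \<comment> \<open>The linear part \<open>f\<close> cancels at the midpoint, so the parallelogram
    identity for the norm carries over to \<open>q\<close>.\<close>
  have qmid: "(norm (a - b))\<^sup>2 / 4 = q a + q b - 2 * q ((1/2) *\<^sub>R (a + b))" for a b
    using parallelogram_midpoint[of a b] unfolding q_def
    by (simp add: f.scaleR f.add algebra_simps)
  have "Cauchy Y"
  proof (rule metric_CauchyI)
    fix e :: real assume "e > 0"
    \<comment> \<open>Both values lie within 1/(N+1) of \<open>m\<close>, and twice the midpoint
      value is at least \<open>2 * m\<close>; so \<open>qmid\<close> gives less than 2 * e^2/8 =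
      e^2/4.\<close>
    then obtain N where N: "1 / real (Suc N) < e\<^sup>2 / 8"
      using nat_approx_posE[of "e\<^sup>2 / 8"] by (auto simp: divide_simps)
    show "\<exists>M. \<forall>i\<ge>M. \<forall>n\<ge>M. dist (Y i) (Y n) < e"
    proof (intro exI allI impI)
      fix i n assume "N \<le> i" "N \<le> n"
      then have "1 / real (Suc i) \<le> 1 / real (Suc N)" "1 / real (Suc n) \<le> 1 / real (Suc N)"
        by (auto intro!: divide_left_mono)
      then have "(norm (Y i - Y n))\<^sup>2 / 4 < e\<^sup>2 / 4"
        using qmid[of "Y i" "Y n"] m_le[of "(1/2) *\<^sub>R (Y i + Y n)"] Y[of i] Y[of n] N by linarith
      then show "dist (Y i) (Y n) < e"
        using \<open>e > 0\<close> by (simp add: dist_norm power2_less_imp_less)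
    qed
  qed
  then obtain y where y: "Y \<longlonglongrightarrow> y" by (auto simp: Cauchy_convergent_iff convergent_def)
  have "(\<lambda>n. q (Y n)) \<longlonglongrightarrow> q y" unfolding q_def by (intro tendsto_intros f.tendsto y) auto
  moreover have "(\<lambda>n. m + 1 / real (Suc n)) \<longlonglongrightarrow> m + 0"
    by (intro tendsto_intros LIMSEQ_Suc lim_1_over_n)
  ultimately have "q y \<le> m + 0"
    by (rule LIMSEQ_le) (use Y in \<open>auto intro: less_imp_le\<close>)
  then have min: "q y \<le> q w" for w using m_le[of w] by simp
  have "f h = inner y h" for h
  proof (cases "h = 0")
    case False
    define d where "d = f h - inner y h"
    \<comment> \<open>This \<open>s\<close> minimizes the quadratic s |->
      \<open>q (y + s *\<^sub>R h)\<close>, whose slope at 0 is \<open>- d\<close>; minimality of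
      \<open>y\<close> then forces \<open>d = 0\<close>.\<close>
    define s where "s = d / (norm h)\<^sup>2"
    have "q (y + s *\<^sub>R h) = q y - s * d + s\<^sup>2 * (norm h)\<^sup>2 / 2"
      unfolding q_def d_def
      by (simp add: power2_norm_eq_inner inner_simps f.add f.scaleR inner_commute[of h y])
         (simp add: algebra_simps power2_eq_square)
    also have "\<dots> = q y - d\<^sup>2 / (norm h)\<^sup>2 / 2"
      using False unfolding s_def by (simp add: field_simps power2_eq_square)
    finally have "d\<^sup>2 / (norm h)\<^sup>2 \<le> 0" using min[of "y + s *\<^sub>R h"] by simp
    then have "d = 0" using False by (simp add: divide_le_0_iff)
    then show ?thesis by (simp add: d_def)
  qed (simp add: f.zero)
  then show ?thesis by blast
qed

definition riesz :: "('a::{real_inner, complete_space} \<Rightarrow>\<^sub>L real) \<Rightarrow> 'a" where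
  "riesz F = (SOME y. \<forall>h. blinfun_apply F h = inner y h)"

lemma inner_riesz: "inner (riesz F) h = blinfun_apply F h"
proof -
  have "\<exists>y. \<forall>h. blinfun_apply F h = inner y h"
    by (intro riesz_representation blinfun.bounded_linear_right)
  then have "\<forall>h. blinfun_apply F h = inner (riesz F) h"
    unfolding riesz_def by (rule someI_ex)
  then show ?thesis by simp
qed

text \<open>A vector is determined by its inner products, which gives linearity; testing
  \<open>F\<close> on \<open>riesz F\<close> itself gives the bound 1. Boundedness lets
  \<open>riesz\<close> carry derivatives of dual-valued maps over to vector-valued ones.\<close>

lemma bounded_linear_riesz: "bounded_linear riesz"
proof (rule bounded_linear_intro[where K = 1])
  fix F G :: "'a \<Rightarrow>\<^sub>L real" and c :: real
  have "\<forall>h. inner (riesz (F + G)) h = inner (riesz F + riesz G) h"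
    by (simp add: inner_riesz inner_add_left plus_blinfun.rep_eq)
  then show "riesz (F + G) = riesz F + riesz G" by (simp only: vector_eq_rdot)
  have "\<forall>h. inner (riesz (c *\<^sub>R F)) h = inner (c *\<^sub>R riesz F) h"
    by (simp add: inner_riesz scaleR_blinfun.rep_eq)
  then show "riesz (c *\<^sub>R F) = c *\<^sub>R riesz F" by (simp only: vector_eq_rdot)
  have "(norm (riesz F))\<^sup>2 = blinfun_apply F (riesz F)"
    by (simp add: power2_norm_eq_inner inner_riesz)
  also have "\<dots> \<le> norm F * norm (riesz F)"
    using norm_blinfun[of F "riesz F"] by simp
  finally show "norm (riesz F) \<le> norm F * 1"
    by (cases "riesz F = 0") (auto simp: power2_eq_square)
qed

section \<open>Gradient and Hessian of a twice differentiable function\<close>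

lemma gradient_eqI:
  assumes "GDERIV f x :> g"
  shows "gradient f x = g"
  unfolding gradient_def
proof (rule the_equality[of _ g])
  fix g' assume "GDERIV f x :> g'"
  then have "(\<lambda>h. inner h g') = (\<lambda>h. inner h g)"
    using assms unfolding gderiv_def by (rule has_derivative_unique)
  then show "g' = g" by (metis vector_eq_ldot)
qed fact

text \<open>The gradient is \<open>riesz\<close> composed with the dual-valued derivative
  \<open>f'\<close>, so it inherits differentiability from \<open>f'\<close>.\<close>

lemma C2_on_UNIV_gradient:
  fixes f :: "'a::{real_inner, complete_space} \<Rightarrow> real"
  assumes "C2_on UNIV f"
  shows "GDERIV f x :> gradient f x"
    and "(gradient f has_derivative hessian f x) (at x)"
proof -
  obtain f' :: "'a \<Rightarrow> 'a \<Rightarrow>\<^sub>L real" and f'' :: "'a \<Rightarrow> 'a \<Rightarrow>\<^sub>L ('a \<Rightarrow>\<^sub>L real)"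
    where f': "\<And>x. (f has_derivative blinfun_apply (f' x)) (at x)"
      and f'': "\<And>x. (f' has_derivative blinfun_apply (f'' x)) (at x)"
    using assms unfolding C2_on_def by auto
  have G: "GDERIV f x :> riesz (f' x)" for x
    using f'[of x] by (simp add: gderiv_def inner_commute[of _ "riesz _"] inner_riesz)
  then have grad: "gradient f = (\<lambda>x. riesz (f' x))" by (auto intro: gradient_eqI)
  show "GDERIV f x :> gradient f x" using G by (simp add: grad)
  have "gradient f differentiable at x"
    unfolding grad
    using bounded_linear.has_derivative[OF bounded_linear_riesz f''] by (rule differentiableI)
  then show "(gradient f has_derivative hessian f x) (at x)"
    unfolding hessian_def by (simp add: frechet_derivative_works)
qed

text \<open>Restriction to the line through \<open>x\<close> and \<open>y\<close> reduces this to
  the tangent inequality for a convex function of one real variable, taken at 0 and evaluated at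
  1.\<close>

lemma convex_on_gradient_le:
  fixes f :: "'a::real_inner \<Rightarrow> real"
  assumes "convex_on UNIV f" and g: "GDERIV f x :> g"
  shows "f x + inner g (y - x) \<le> f y"
proof -
  define \<phi> where "\<phi> s = f (x + s *\<^sub>R (y - x))" for s :: real
  have "convex_on UNIV \<phi>"
  proof (rule convex_onI)
    fix t a b :: real assume "0 < t" "t < 1"
    have "x + ((1 - t) *\<^sub>R a + t *\<^sub>R b) *\<^sub>R (y - x)
        = (1 - t) *\<^sub>R (x + a *\<^sub>R (y - x)) + t *\<^sub>R (x + b *\<^sub>R (y - x))"
      by (simp add: algebra_simps)
    then show "\<phi> ((1 - t) *\<^sub>R a + t *\<^sub>R b) \<le> (1 - t) * \<phi> a + t * \<phi> b"
      unfolding \<phi>_def using convex_onD[OF assms(1)] \<open>0 < t\<close> \<open>t < 1\<close> by simp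
  qed simp
  moreover have "(\<phi> has_real_derivative inner g (y - x)) (at 0)"
  proof -
    have f0: "(f has_derivative (\<lambda>h. inner h g)) (at (x + 0 *\<^sub>R (y - x)))"
      using g by (simp add: gderiv_def)
    have "((\<lambda>s. x + s *\<^sub>R (y - x)) has_derivative (\<lambda>s. s *\<^sub>R (y - x))) (at (0::real))"
      by (auto intro!: derivative_eq_intros)
    from has_derivative_compose[OF this f0] show ?thesis
      unfolding \<phi>_def has_field_derivative_def
      by (rule has_derivative_eq_rhs) (auto simp: inner_commute mult.commute)
  qed
  ultimately have "\<phi> 1 - \<phi> 0 \<ge> inner g (y - x) * (1 - 0)"
    by (intro convex_on_imp_above_tangent[of UNIV]) auto
  then show ?thesis by (simp add: \<phi>_def)
qed

section \<open>Uniformly monotone gradients\<close>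

lemma gradient_argmin:
  assumes "GDERIV f z :> g" and "z \<in> argmin f"
  shows "g = 0"
proof -
  have "(\<lambda>h. inner h g) = (\<lambda>h. 0)"
    using assms by (intro has_derivative_local_min[of f])
      (auto simp: gderiv_def argmin_def is_arg_min_def not_less)
  then have "inner g g = 0" by metis
  then show ?thesis by simp
qed

text \<open>On a ball, \<open>f y - f z\<close> is at least \<omega> of half the distance from
  \<open>y\<close> to \<open>z\<close>. As \<omega> is nondecreasing and positive away from 0,
  values near the minimum force points near \<open>z\<close>.\<close>

lemma uniformly_monotone_values_tendsto:
  fixes f :: "'a::real_inner \<Rightarrow> real" and x :: "'b \<Rightarrow> 'a"
  assumes conv: "convex_on UNIV f" and grad: "\<And>y. GDERIV f y :> g y"
    and mono: "uniformly_monotone_on_bounded_sets g"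
    and z: "z \<in> argmin f"
    and bdd: "eventually (\<lambda>t. norm (x t) \<le> B) F"
    and lim: "((\<lambda>t. f (x t)) \<longlongrightarrow> f z) F"
  shows "(x \<longlongrightarrow> z) F"
proof -
  \<comment> \<open>The ball of radius \<open>r\<close> contains \<open>z\<close> and every midpoint
    used below; the summand 1 keeps \<open>r\<close> positive.\<close>
  define r where "r = max B (norm z) + 1"
  have "r > 0" unfolding r_def using norm_ge_zero[of z] by linarith
  with mono obtain \<omega> :: "real \<Rightarrow> real" where \<omega>: "mono_on {0..} \<omega>" "\<And>s. s \<ge> 0 \<Longrightarrow> \<omega> s \<ge> 0"
    "\<And>s. s \<ge> 0 \<Longrightarrow> \<omega> s = 0 \<longleftrightarrow> s = 0"
    "\<And>x y. norm x \<le> r \<Longrightarrow> norm y \<le> r \<Longrightarrow> inner (g x - g y) (x - y) \<ge> \<omega> (norm (x - y))"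
    unfolding uniformly_monotone_on_bounded_sets_def by blast
  have gz: "g z = 0" using gradient_argmin[OF grad z] .
  have growth: "f y - f z \<ge> \<omega> (norm (y - z) / 2)" if "norm y \<le> B" for y
  proof -
    \<comment> \<open>At the midpoint, \<open>y - p = p - z\<close>, so monotonicity between
      \<open>p\<close> and \<open>z\<close>, with \<open>g z = 0\<close>, bounds the slope of the
      tangent at \<open>p\<close> in the direction of \<open>y\<close>.\<close>
    define p where "p = (1/2) *\<^sub>R (y + z)"
    have "norm p \<le> r"
      using that norm_triangle_ineq[of y z] unfolding p_def r_def by simp
    moreover have "norm z \<le> r" unfolding r_def by simp
    moreover have pz: "p - z = (1/2) *\<^sub>R (y - z)" and yp: "y - p = p - z"
      unfolding p_def by (simp_all add: algebra_simps flip: scaleR_add_left)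
    ultimately have "inner (g p) (y - p) \<ge> \<omega> (norm (y - z) / 2)"
      using \<omega>(4)[of p z] gz by simp
    moreover have "f p \<ge> f z"
      using z by (auto simp: argmin_def is_arg_min_def not_less)
    ultimately show ?thesis using convex_on_gradient_le[OF conv grad, of p y] by linarith
  qed
  show ?thesis
  proof (rule tendstoI)
    fix e :: real assume "e > 0"
    then have "\<omega> (e / 2) > 0" using \<omega>(2)[of "e/2"] \<omega>(3)[of "e/2"] by fastforce
    then have "eventually (\<lambda>t. f (x t) < f z + \<omega> (e / 2)) F"
      using lim by (intro order_tendstoD(2)[OF lim]) simp
    with bdd show "eventually (\<lambda>t. dist (x t) z < e) F"
    proof eventually_elim
      case (elim t)
      show ?case
      proof (rule ccontr)
        assume "\<not> dist (x t) z < e"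
        then have "\<omega> (e / 2) \<le> \<omega> (norm (x t - z) / 2)"
          using \<open>e > 0\<close> by (intro mono_onD[OF \<omega>(1)]) (auto simp: dist_norm)
        with growth[of "x t"] elim show False by linarith
      qed
    qed
  qed
qed

section \<open>Trajectories\<close>

lemma blinfun_apply_real:
  fixes F :: "real \<Rightarrow>\<^sub>L 'a::real_normed_vector"
  shows "blinfun_apply F h = h *\<^sub>R blinfun_apply F 1"
  using blinfun.scaleR_right[of F h 1] by simp

text \<open>Passes from the one-sided derivatives in the definition of a solution to two-sided ones
  at interior times.\<close>

lemma C2_on_atLeast_derivatives:
  fixes x :: "real \<Rightarrow> 'a::real_normed_vector"
  assumes "C2_on {t0..} x" and "t0 < t"
  defines "x' \<equiv> \<lambda>t. vector_derivative x (at t within {t0..})"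
  shows "(x has_vector_derivative x' t) (at t)"
    and "(x' has_vector_derivative vector_derivative x' (at t within {t0..})) (at t)"
proof -
  obtain f' :: "real \<Rightarrow> real \<Rightarrow>\<^sub>L 'a" and f'' :: "real \<Rightarrow> real \<Rightarrow>\<^sub>L (real \<Rightarrow>\<^sub>L 'a)"
    where f': "\<And>s. s \<ge> t0 \<Longrightarrow> (x has_derivative blinfun_apply (f' s)) (at s within {t0..})"
      and f'': "\<And>s. s \<ge> t0 \<Longrightarrow> (f' has_derivative blinfun_apply (f'' s)) (at s within {t0..})"
    using assms(1) unfolding C2_on_def by auto
  \<comment> \<open>The endpoint \<open>s = t0\<close> is included because \<open>x'\<close> must
    agree with \<open>f'\<close> evaluated at 1 on the whole half-line before it can be
    differentiated within it.\<close>
  have nontriv: "at s within {t0..} \<noteq> bot" if "s \<ge> t0" for s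
  proof -
    have "at s within {s..} \<noteq> bot"
      using trivial_limit_at_right_real[of s] at_within_Ici_at_right[of s] by (simp add: trivial_limit_def)
    moreover have "at s within {s..} \<le> at s within {t0..}"
      using that by (intro at_le) auto
    ultimately show ?thesis by (metis bot.extremum_uniqueI)
  qed
  have within: "at t within {t0..} = at t"
    using \<open>t0 < t\<close> at_within_interior[of t "{t0..}"] by simp
  have d1: "(x has_vector_derivative blinfun_apply (f' s) 1) (at s within {t0..})" if "s \<ge> t0" for s
    using f'[OF that] unfolding has_vector_derivative_def
    by (rule has_derivative_eq_rhs) (rule ext, rule blinfun_apply_real)
  have x': "x' s = blinfun_apply (f' s) 1" if "s \<ge> t0" for s
    unfolding x'_def by (rule vector_derivative_within[OF nontriv d1]) (use that in auto)
  show "(x has_vector_derivative x' t) (at t)"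
    using d1[of t] x'[of t] \<open>t0 < t\<close> by (simp add: within)
  have "((\<lambda>s. blinfun_apply (f' s) 1) has_derivative (\<lambda>h. blinfun_apply (blinfun_apply (f'' t) h) 1))
      (at t within {t0..})"
    using f''[of t] \<open>t0 < t\<close> by (intro bounded_linear.has_derivative[OF blinfun.bounded_linear_left]) auto
  then have "((\<lambda>s. blinfun_apply (f' s) 1) has_vector_derivative blinfun_apply (blinfun_apply (f'' t) 1) 1)
      (at t within {t0..})"
    unfolding has_vector_derivative_def
    by (rule has_derivative_eq_rhs)
       (rule ext, subst blinfun_apply_real, simp only: blinfun.scaleR_left)
  then have d2: "(x' has_vector_derivative blinfun_apply (blinfun_apply (f'' t) 1) 1) (at t within {t0..})"
    by (rule has_vector_derivative_transform[rotated 2]) (use x' \<open>t0 < t\<close> in auto)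
  then have "vector_derivative x' (at t within {t0..}) = blinfun_apply (blinfun_apply (f'' t) 1) 1"
    using nontriv[of t] \<open>t0 < t\<close> by (intro vector_derivative_within) auto
  with d2 show "(x' has_vector_derivative vector_derivative x' (at t within {t0..})) (at t)"
    by (simp add: within)
qed

section \<open>Lyapunov function and its decay\<close>

text \<open>The equation removes \<open>x''\<close> and \<open>G'\<close> from the derivative of the
  vector inside the norm. The coefficients of \<open>W t\<close> and of the last square are chosen
  to cancel the products of \<open>x' t\<close> with \<open>G t\<close> and with
  \<open>x t - z\<close>.\<close>

lemma lyapunov_derivative:
  fixes x x' G :: "real \<Rightarrow> 'a::real_inner" and W :: "real \<Rightarrow> real"
  assumes dx: "(x has_vector_derivative x' t) (at t)"
    and dx': "(x' has_vector_derivative x'') (at t)"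
    and dG: "(G has_vector_derivative G') (at t)"
    and dW: "(W has_real_derivative inner (G t) (x' t)) (at t)"
    and ode: "x'' + (\<alpha> / t) *\<^sub>R x' t + \<beta> *\<^sub>R G' + G t = 0"
    and "t > 0"
  shows "((\<lambda>t. (t\<^sup>2 - \<beta> * (l + 2 - \<alpha>) * t) * W t
            + (norm (l *\<^sub>R (x t - z) + t *\<^sub>R (x' t + \<beta> *\<^sub>R G t)))\<^sup>2 / 2
            + l * (\<alpha> - l - 1) / 2 * (norm (x t - z))\<^sup>2)
          has_real_derivative
            (2 * t - \<beta> * (l + 2 - \<alpha>)) * W t - (\<alpha> - 1 - l) * t * (norm (x' t))\<^sup>2
            - (t - \<beta>) * l * inner (G t) (x t - z) - \<beta> * t * (t - \<beta>) * (norm (G t))\<^sup>2) (at t)"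
proof -
  define u where "u t = l *\<^sub>R (x t - z) + t *\<^sub>R (x' t + \<beta> *\<^sub>R G t)" for t
  define u' where "u' = (l + 1 - \<alpha>) *\<^sub>R x' t + (\<beta> - t) *\<^sub>R G t"
  have sq: "((\<lambda>t. (norm (w t))\<^sup>2) has_real_derivative 2 * inner (w t) w') (at t)"
    if "(w has_vector_derivative w') (at t)" for w :: "real \<Rightarrow> 'a" and w'
  proof -
    have "(w has_derivative (\<lambda>h. h *\<^sub>R w')) (at t)"
      using that by (simp add: has_vector_derivative_def)
    from has_derivative_inner[OF this this] show ?thesis
      unfolding power2_norm_eq_inner has_field_derivative_def
      by (rule has_derivative_eq_rhs) (auto simp: inner_commute)
  qed
  have x''_eq: "x'' = - ((\<alpha> / t) *\<^sub>R x' t + \<beta> *\<^sub>R G' + G t)"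
    using ode by (subst eq_neg_iff_add_eq_0) (simp add: add.assoc)
  have "(u has_vector_derivative
      l *\<^sub>R x' t + (t *\<^sub>R (x'' + \<beta> *\<^sub>R G') + (x' t + \<beta> *\<^sub>R G t))) (at t)"
    unfolding u_def using dx dx' dG
    by (auto intro!: derivative_eq_intros)
  also have "l *\<^sub>R x' t + (t *\<^sub>R (x'' + \<beta> *\<^sub>R G') + (x' t + \<beta> *\<^sub>R G t)) = u'"
    using \<open>t > 0\<close> unfolding x''_eq u'_def by (simp add: algebra_simps)
  finally have du: "(u has_vector_derivative u') (at t)" .
  have dxz: "((\<lambda>t. x t - z) has_vector_derivative x' t) (at t)"
    using dx by (auto intro!: derivative_eq_intros)
  have "((\<lambda>t. (t\<^sup>2 - \<beta> * (l + 2 - \<alpha>) * t) * W t + (norm (u t))\<^sup>2 / 2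
            + l * (\<alpha> - l - 1) / 2 * (norm (x t - z))\<^sup>2)
          has_real_derivative
            (2 * t - \<beta> * (l + 2 - \<alpha>)) * W t + (t\<^sup>2 - \<beta> * (l + 2 - \<alpha>) * t) * inner (G t) (x' t)
            + inner (u t) u' + l * (\<alpha> - l - 1) * inner (x t - z) (x' t)) (at t)"
    by (rule derivative_eq_intros dW sq[OF du] sq[OF dxz] refl | simp)+
  moreover have "(2 * t - \<beta> * (l + 2 - \<alpha>)) * W t + (t\<^sup>2 - \<beta> * (l + 2 - \<alpha>) * t) * inner (G t) (x' t)
            + inner (u t) u' + l * (\<alpha> - l - 1) * inner (x t - z) (x' t)
      = (2 * t - \<beta> * (l + 2 - \<alpha>)) * W t - (\<alpha> - 1 - l) * t * (norm (x' t))\<^sup>2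
            - (t - \<beta>) * l * inner (G t) (x t - z) - \<beta> * t * (t - \<beta>) * (norm (G t))\<^sup>2"
  proof -
    define d where "d = x t - z"
    show ?thesis
      unfolding u_def u'_def power2_norm_eq_inner d_def[symmetric]
      by (simp add: inner_simps inner_commute[of "x' t" "G t"] inner_commute[of d "G t"]
            inner_commute[of d "x' t"])
         (simp add: algebra_simps power2_eq_square)
  qed
  ultimately show ?thesis unfolding u_def by simp
qed

text \<open>\<open>W\<close> stands for the value gap and \<open>G\<close> for the gradient along
  the trajectory; convexity enters through \<open>W_le\<close>. For large \<open>t\<close> the
  energy is nonincreasing with nonnegative terms, so its initial value bounds each of them.\<close>

lemma lyapunov_bounds:
  fixes x x' x'' G G' :: "real \<Rightarrow> 'a::real_inner" and W :: "real \<Rightarrow> real"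
  assumes "\<alpha> > 3" "\<beta> > 0"
    and dx: "\<And>t. t > t0 \<Longrightarrow> (x has_vector_derivative x' t) (at t)"
    and dx': "\<And>t. t > t0 \<Longrightarrow> (x' has_vector_derivative x'' t) (at t)"
    and dG: "\<And>t. t > t0 \<Longrightarrow> (G has_vector_derivative G' t) (at t)"
    and dW: "\<And>t. t > t0 \<Longrightarrow> (W has_real_derivative inner (G t) (x' t)) (at t)"
    and ode: "\<And>t. t > t0 \<Longrightarrow> x'' t + (\<alpha> / t) *\<^sub>R x' t + \<beta> *\<^sub>R G' t + G t = 0"
    and W_nonneg: "\<And>t. W t \<ge> 0"
    and W_le: "\<And>t. W t \<le> inner (G t) (x t - z)"
  shows "\<exists>C. eventually (\<lambda>t. W t \<le> C / t\<^sup>2 \<and> norm (x t - z) \<le> C) at_top"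
proof -
  \<comment> \<open>The midpoint of the interval from 2 to \<alpha> - 1, nonempty as \<alpha> > 3.
    The lower bound makes the \<open>W\<close> terms of \<open>E'\<close> eventually nonpositive;
    the upper one makes the velocity term dissipative and \<open>c\<close> positive.\<close>
  define l where "l = (\<alpha> + 1) / 2"
  have l: "2 < l" "l < \<alpha> - 1" using \<open>\<alpha> > 3\<close> by (auto simp: l_def)
  define c where "c = l * (\<alpha> - l - 1) / 2"
  have "c > 0" unfolding c_def using l by simp
  define a where "a t = t\<^sup>2 - \<beta> * (l + 2 - \<alpha>) * t" for t
  define E where "E t = a t * W t
            + (norm (l *\<^sub>R (x t - z) + t *\<^sub>R (x' t + \<beta> *\<^sub>R G t)))\<^sup>2 / 2
            + c * (norm (x t - z))\<^sup>2" for t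
  define E' where "E' t = (2 * t - \<beta> * (l + 2 - \<alpha>)) * W t - (\<alpha> - 1 - l) * t * (norm (x' t))\<^sup>2
            - (t - \<beta>) * l * inner (G t) (x t - z) - \<beta> * t * (t - \<beta>) * (norm (G t))\<^sup>2" for t
  \<comment> \<open>In order: interior times, positive times, the sign of
    \<open>t - \<beta>\<close>, the sign of the \<open>W\<close> terms in \<open>E'\<close>, and
    \<open>a t\<close> at least half of t^2.\<close>
  define T where "T = Max {t0 + 1, 1, \<beta>, \<beta> * (\<alpha> - 2) / (l - 2), 2 * (\<beta> * (l + 2 - \<alpha>))}"
  have T: "t > t0" "t \<ge> 1" "t \<ge> \<beta>" "t \<ge> \<beta> * (\<alpha> - 2) / (l - 2)" "t \<ge> 2 * (\<beta> * (l + 2 - \<alpha>))"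
    if "t \<ge> T" for t
    using that by (auto simp: T_def)
  have dE: "(E has_real_derivative E' t) (at t)" if "t \<ge> T" for t
    unfolding E_def E'_def a_def c_def
    using T[OF that] by (intro lyapunov_derivative[OF dx dx' dG dW ode]) auto
  have E'_le: "E' t \<le> 0" if "t \<ge> T" for t
  proof -
    \<comment> \<open>Replacing the inner product by \<open>W t\<close> leaves the total coefficient
      \<open>- (t * (l - 2) - \<beta> * (\<alpha> - 2))\<close> of \<open>W t\<close>.\<close>
    have "(t - \<beta>) * l * W t \<le> (t - \<beta>) * l * inner (G t) (x t - z)"
      using T[OF that] l by (intro mult_left_mono W_le) auto
    moreover have "0 \<le> (\<alpha> - 1 - l) * t * (norm (x' t))\<^sup>2" "0 \<le> \<beta> * t * (t - \<beta>) * (norm (G t))\<^sup>2"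
      using T[OF that] l \<open>\<beta> > 0\<close> by auto
    moreover have "\<beta> * (\<alpha> - 2) \<le> t * (l - 2)"
      using T(4)[OF that] l by (simp add: divide_le_eq)
    then have "0 \<le> (t * (l - 2) - \<beta> * (\<alpha> - 2)) * W t" using W_nonneg by simp
    then have "(2 * t - \<beta> * (l + 2 - \<alpha>)) * W t - (t - \<beta>) * l * W t \<le> 0"
      by (simp add: algebra_simps)
    ultimately show ?thesis unfolding E'_def by linarith
  qed
  have E_le: "E t \<le> E T" if "t \<ge> T" for t
    using that by (rule DERIV_nonpos_imp_nonincreasing) (use dE E'_le in blast)
  have a_ge: "t\<^sup>2 / 2 \<le> a t" if "t \<ge> T" for t
  proof -
    have "2 * (\<beta> * (l + 2 - \<alpha>)) * t \<le> t * t"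
      using T[OF that] by (intro mult_right_mono) auto
    then show ?thesis by (simp add: a_def power2_eq_square)
  qed
  \<comment> \<open>The first entry comes from the value term of the energy, the second from its
    \<open>c\<close> term.\<close>
  define C where "C = Max {2 * E T, sqrt (E T / c)}"
  have "W t \<le> C / t\<^sup>2 \<and> norm (x t - z) \<le> C" if "t \<ge> T" for t
  proof
    have "t > 0" using T[OF that] by simp
    have aW: "t\<^sup>2 / 2 * W t \<le> a t * W t" by (intro mult_right_mono a_ge W_nonneg that)
    moreover have "0 \<le> t\<^sup>2 / 2 * W t" using W_nonneg by simp
    moreover have "0 \<le> c * (norm (x t - z))\<^sup>2" using \<open>c > 0\<close> by simp
    ultimately have *: "t\<^sup>2 / 2 * W t \<le> E T" "c * (norm (x t - z))\<^sup>2 \<le> E T"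
      using E_le[OF that] zero_le_power2[of "norm (l *\<^sub>R (x t - z) + t *\<^sub>R (x' t + \<beta> *\<^sub>R G t))"]
      unfolding E_def[of t] by linarith+
    have "W t * t\<^sup>2 \<le> C"
      using *(1) unfolding C_def by (simp add: mult.commute le_max_iff_disj)
    then show "W t \<le> C / t\<^sup>2" using \<open>t > 0\<close> by (simp add: le_divide_eq)
    have "norm (x t - z) \<le> sqrt (E T / c)"
      using *(2) \<open>c > 0\<close> by (intro real_le_rsqrt) (simp add: le_divide_eq mult.commute)
    then show "norm (x t - z) \<le> C" unfolding C_def by simp
  qed
  then show ?thesis unfolding eventually_at_top_linorder by blast
qed

theorem theorem2p4:
  fixes \<Phi> :: "'a::{real_inner, complete_space} \<Rightarrow> real"
    and x :: "real \<Rightarrow> 'a"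
    and \<alpha> \<beta> t0 :: real
  assumes "\<alpha> > 3" and "\<beta> > 0" and "t0 > 0"
    and "C2_on UNIV \<Phi>"
    and "convex_on UNIV \<Phi>"
    and "argmin \<Phi> \<noteq> {}"
    and "uniformly_monotone_on_bounded_sets (gradient \<Phi>)"
    and "classical_global_solution \<alpha> \<beta> t0 \<Phi> x"
  shows "\<exists>xs. argmin \<Phi> = {xs} \<and> (x \<longlongrightarrow> xs) at_top"
proof -
  note grad = C2_on_UNIV_gradient(1)[OF assms(4)]
  \<comment> \<open>Convergence is shown to every minimizer; uniqueness of limits then makes the
    argmin a singleton.\<close>
  have lim: "(x \<longlongrightarrow> z) at_top" if z: "z \<in> argmin \<Phi>" for z
  proof -
    define x' where "x' t = vector_derivative x (at t within {t0..})" for t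
    define x'' where "x'' t = vector_derivative x' (at t within {t0..})" for t
    have C2: "C2_on {t0..} x"
      and ode: "\<And>t. t \<ge> t0 \<Longrightarrow>
        x'' t + (\<alpha> / t) *\<^sub>R x' t + \<beta> *\<^sub>R hessian \<Phi> (x t) (x' t) + gradient \<Phi> (x t) = 0"
      using assms(8) unfolding classical_global_solution_def Let_def x''_def x'_def[abs_def] by auto
    have dx: "(x has_vector_derivative x' t) (at t)"
      and dx': "(x' has_vector_derivative x'' t) (at t)" if "t > t0" for t
      using C2_on_atLeast_derivatives[OF C2 that] unfolding x''_def x'_def[abs_def] by auto
    have dG: "((\<lambda>t. gradient \<Phi> (x t)) has_vector_derivative hessian \<Phi> (x t) (x' t)) (at t)"
      if "t > t0" for t
      using vector_derivative_diff_chain_within[OF dx[OF that], of "gradient \<Phi>" "hessian \<Phi> (x t)"]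
        has_derivative_at_withinI[OF C2_on_UNIV_gradient(2)[OF assms(4)]]
      by (simp add: o_def)
    have dW: "((\<lambda>t. \<Phi> (x t) - \<Phi> z) has_real_derivative inner (gradient \<Phi> (x t)) (x' t)) (at t)"
      if "t > t0" for t
    proof -
      have "((\<lambda>t. \<Phi> (x t)) has_vector_derivative inner (x' t) (gradient \<Phi> (x t))) (at t)"
        using vector_derivative_diff_chain_within[OF dx[OF that], of \<Phi> "\<lambda>h. inner h (gradient \<Phi> (x t))"]
          has_derivative_at_withinI[OF grad[unfolded gderiv_def]]
        by (simp add: o_def)
      then show ?thesis
        by (auto intro!: derivative_eq_intros
            simp: has_real_derivative_iff_has_vector_derivative[symmetric] inner_commute)
    qed
    have "\<Phi> (x t) - \<Phi> z \<ge> 0" for t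
      using z by (auto simp: argmin_def is_arg_min_def not_less)
    moreover have "\<Phi> (x t) - \<Phi> z \<le> inner (gradient \<Phi> (x t)) (x t - z)" for t
      using convex_on_gradient_le[OF assms(5) grad, of "x t" z] by (simp add: inner_diff_right)
    ultimately obtain C where
      C: "eventually (\<lambda>t. \<Phi> (x t) - \<Phi> z \<le> C / t\<^sup>2 \<and> norm (x t - z) \<le> C) at_top"
      using lyapunov_bounds[where z = z, OF assms(1,2) dx dx' dG dW ode[OF less_imp_le]] by blast
    show ?thesis
    proof (rule uniformly_monotone_values_tendsto[OF assms(5) grad assms(7) z])
      show "eventually (\<lambda>t. norm (x t) \<le> norm z + C) at_top"
        using C
      proof eventually_elim
        case (elim t)
        then show ?case using norm_triangle_sub[of "x t" z] by linarith
      qed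
      have "((\<lambda>t. C / t\<^sup>2) \<longlongrightarrow> 0) at_top"
        by (intro tendsto_divide_0[OF tendsto_const] filterlim_at_top_imp_at_infinity
            filterlim_pow_at_top filterlim_ident) auto
      then have "((\<lambda>t. \<Phi> (x t) - \<Phi> z) \<longlongrightarrow> 0) at_top"
      proof (rule tendsto_sandwich[rotated 3])
        show "eventually (\<lambda>t. 0 \<le> \<Phi> (x t) - \<Phi> z) at_top"
          using z by (auto simp: argmin_def is_arg_min_def not_less)
        show "eventually (\<lambda>t. \<Phi> (x t) - \<Phi> z \<le> C / t\<^sup>2) at_top"
          using C by eventually_elim simp
      qed simp
      then show "((\<lambda>t. \<Phi> (x t)) \<longlongrightarrow> \<Phi> z) at_top" by (rule LIM_zero_cancel)
    qed
  qed
  obtain z where z: "z \<in> argmin \<Phi>" using assms(6) by auto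
  have "y = z" if "y \<in> argmin \<Phi>" for y
    using tendsto_unique[OF _ lim[OF that] lim[OF z]] by simp
  with z lim show ?thesis by blast
qed

end
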